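(* Let $n\ge 2$ and $d\ge 1$ be integers, let $R=\mathbb{Z}/n\mathbb{Z}$, and let $g=a_0+a_1t+\cdots+a_dt^d\in R[t]$ be a monic polynomial of degree $d$ (so $a_d=1$) which is invertible in the power series ring $R[[t]]$ (i.e. $a_0$ is invertible in $R$). Let $A_g=(R^d,R,\rho,\tau)$ be the invertible automaton with set of states $R^d$, alphabet $R$, and $$\rho((y_1,\dots,y_d),x)=a_dy_1+a_{d-1}y_2+\cdots+a_1y_d+a_0x,\qquad \tau((y_1,\dots,y_d),x)=(y_2,\dots,y_d,x).$$ Then the group $G(A_g)$ of this automaton is isomorphic to the lamplighter group $$L_{n,d}=\Big(\bigoplus_{\mathbb{Z}}(\mathbb{Z}/n\mathbb{Z})^d\Big)\rtimes\mathbb{Z}=(\mathbb{Z}/n\mathbb{Z})^d\wr\mathbb{Z},$$ where $\mathbb{Z}$ acts by translating the index set $\mathbb{Z}$ of the direct sum.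
   Context: An automaton is a quadruple $A=(Q,X,\rho,\tau)$ with $Q$ a finite set (states), $X$ a finite set (alphabet), and functions $\rho:Q\times X\to X$ (rewriting) and $\tau:Q\times X\to Q$ (transition). It is invertible if for every $q\in Q$ the map $\rho_q:X\to X$, $x\mapsto\rho(q,x)$, is a permutation. Each state $q$ of an invertible automaton defines an automorphism, also denoted $q$, of the rooted tree $X^*$ of finite words over $X$ (equivalently a transformation of the infinite words over $X$), recursively by $q(\emptyset)=\emptyset$ and $q(xw)=\rho(q,x)\,q_x(w)$, where $q_x=\tau(q,x)$, for $x\in X$ and $w$ a word. The group of the automaton, $G(A)$, is the subgroup of $\mathrm{Aut}(X^* )$ generated by the automorphisms defined by all states $q\in Q$. *)

theory Defs
  imports "HOL-Algebra.Bij" "HOL-Algebra.Product_Groups" "HOL-Algebra.UnivPoly" "HOL-Number_Theory.Residues"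
begin

record ('q, 'x) automaton =
  states :: "'q set"
  alphabet :: "'x set"
  rewriting :: "'q \<Rightarrow> 'x \<Rightarrow> 'x"
  transition :: "'q \<Rightarrow> 'x \<Rightarrow> 'q"

locale automaton =
  fixes A :: "('q, 'x) automaton" (structure)
  assumes finite_states: "finite (states A)"
    and finite_alphabet: "finite (alphabet A)"
    and rewriting_closed: "rewriting A \<in> states A \<rightarrow> alphabet A \<rightarrow> alphabet A"
    and transition_closed: "transition A \<in> states A \<rightarrow> alphabet A \<rightarrow> states A"

locale invertible_automaton = automaton +
  assumes rewriting_bij: "q \<in> states A \<Longrightarrow> bij_betw (rewriting A q) (alphabet A) (alphabet A)"

primrec state_action :: "('q, 'x) automaton \<Rightarrow> 'q \<Rightarrow> 'x list \<Rightarrow> 'x list" where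
  "state_action A q [] = []"
| "state_action A q (x # w) = rewriting A q x # state_action A (transition A q x) w"

definition state_automorphism :: "('q, 'x) automaton \<Rightarrow> 'q \<Rightarrow> 'x list \<Rightarrow> 'x list" where
  "state_automorphism A q = restrict (state_action A q) (lists (alphabet A))"

text \<open>The words over \<open>X\<close> form a tree with root the empty word, where \<open>u\<close> is the parent of
  \<open>u @ [x]\<close>.\<close>

definition tree_auto :: "'x set \<Rightarrow> ('x list \<Rightarrow> 'x list) set" where
  "tree_auto X = {f \<in> Bij (lists X). f [] = [] \<and>
     (\<forall>u\<in>lists X. \<forall>v\<in>lists X. (\<exists>x. v = u @ [x]) \<longleftrightarrow> (\<exists>x. f v = f u @ [x]))}"

definition TreeAutoGroup :: "'x set \<Rightarrow> ('x list \<Rightarrow> 'x list) monoid" where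
  "TreeAutoGroup X = BijGroup (lists X) \<lparr>carrier := tree_auto X\<rparr>"

text \<open>\<^const>\<open>subgroup_generated\<close> ignores generators outside the carrier; for invertible automata
  there are none, see \<open>state_automorphism_in_carrier\<close> below.\<close>

definition automaton_group :: "('q, 'x) automaton \<Rightarrow> ('x list \<Rightarrow> 'x list) monoid" where
  "automaton_group A =
     subgroup_generated (TreeAutoGroup (alphabet A)) (state_automorphism A ` states A)"

lemma subgroup_tree_auto: "subgroup (tree_auto X) (BijGroup (lists X))"
proof
  show "tree_auto X \<subseteq> carrier (BijGroup (lists X))"
    by (auto simp: tree_auto_def BijGroup_def)
next
  fix f g assume fg: "f \<in> tree_auto X" "g \<in> tree_auto X"
  then have B: "f \<in> Bij (lists X)" "g \<in> Bij (lists X)" by (auto simp: tree_auto_def)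
  have g_in: "g u \<in> lists X" if "u \<in> lists X" for u
    using Bij_imp_funcset[OF B(2)] that by blast
  have "compose (lists X) f g \<in> tree_auto X"
    using fg compose_Bij[OF B] g_in by (simp add: tree_auto_def compose_def)
  then show "f \<otimes>\<^bsub>BijGroup (lists X)\<^esub> g \<in> tree_auto X"
    using B by (simp add: BijGroup_def)
next
  show "\<one>\<^bsub>BijGroup (lists X)\<^esub> \<in> tree_auto X"
    using id_Bij[of "lists X"] by (simp add: tree_auto_def BijGroup_def)
next
  fix f assume f: "f \<in> tree_auto X"
  then have B: "f \<in> Bij (lists X)" by (auto simp: tree_auto_def)
  let ?h = "inv_into (lists X) f"
  have bij: "bij_betw f (lists X) (lists X)" using B by (simp add: Bij_def)
  have h_in: "?h u \<in> lists X" if "u \<in> lists X" for u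
    using B that by (rule Bij_inv_into_mem)
  have fh: "f (?h u) = u" if "u \<in> lists X" for u
    using bij that by (rule bij_betw_inv_into_right)
  have "?h [] = []"
    using bij_betw_inv_into_left[OF bij, of "[]"] f by (simp add: tree_auto_def)
  moreover have "(\<exists>x. v = u @ [x]) \<longleftrightarrow> (\<exists>x. ?h v = ?h u @ [x])"
    if "u \<in> lists X" "v \<in> lists X" for u v
  proof -
    have "(\<exists>x. ?h v = ?h u @ [x]) \<longleftrightarrow> (\<exists>x. f (?h v) = f (?h u) @ [x])"
      using f h_in[OF that(1)] h_in[OF that(2)] by (simp add: tree_auto_def)
    then show ?thesis using fh that by simp
  qed
  ultimately have "restrict ?h (lists X) \<in> tree_auto X"
    using restrict_inv_into_Bij[OF B] by (simp add: tree_auto_def)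
  then show "inv\<^bsub>BijGroup (lists X)\<^esub> f \<in> tree_auto X"
    using B by (simp add: inv_BijGroup)
qed

lemma group_TreeAutoGroup: "group (TreeAutoGroup X)"
  using subgroup.subgroup_is_group[OF subgroup_tree_auto group_BijGroup]
  by (simp add: TreeAutoGroup_def)

context invertible_automaton
begin

lemma state_action_closed:
  "q \<in> states A \<Longrightarrow> w \<in> lists (alphabet A) \<Longrightarrow> state_action A q w \<in> lists (alphabet A)"
proof (induction w arbitrary: q)
  case (Cons x w)
  then have x: "x \<in> alphabet A" and w: "w \<in> lists (alphabet A)" by auto
  have "rewriting A q x \<in> alphabet A" "transition A q x \<in> states A"
    using rewriting_closed transition_closed Cons.prems(1) x by blast+
  then show ?case using Cons.IH w by simp
qed simp

lemma length_state_action: "length (state_action A q w) = length w"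
  by (induction w arbitrary: q) auto

lemma state_action_inj:
  "q \<in> states A \<Longrightarrow> v \<in> lists (alphabet A) \<Longrightarrow> w \<in> lists (alphabet A) \<Longrightarrow>
   state_action A q v = state_action A q w \<Longrightarrow> v = w"
proof (induction v arbitrary: q w)
  case Nil
  then show ?case using length_state_action[of q w] by simp
next
  case (Cons x v)
  then obtain y w' where w: "w = y # w'" by (cases w) auto
  have "x = y"
    using rewriting_bij[OF Cons.prems(1)] Cons.prems w by (auto simp: bij_betw_def inj_on_def)
  moreover have "transition A q x \<in> states A"
    using transition_closed Cons.prems by auto
  ultimately show ?case using Cons.IH[of "transition A q x" w'] Cons.prems w by auto
qed

lemma state_action_surj:
  "q \<in> states A \<Longrightarrow> w \<in> lists (alphabet A) \<Longrightarrow> \<exists>v\<in>lists (alphabet A). state_action A q v = w"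
proof (induction w arbitrary: q)
  case Nil
  then show ?case by (intro bexI[of _ "[]"]) auto
next
  case (Cons y w)
  then obtain x where x: "x \<in> alphabet A" "rewriting A q x = y"
    using bij_betw_imp_surj_on[OF rewriting_bij[OF Cons.prems(1)]] Cons.prems(2)
    by (metis imageE listsE list.inject list.distinct(1))
  have "transition A q x \<in> states A"
    using transition_closed Cons.prems x by auto
  then obtain v where "v \<in> lists (alphabet A)" "state_action A (transition A q x) v = w"
    using Cons by auto
  then show ?case using x by (intro bexI[of _ "x # v"]) auto
qed

lemma state_action_append1: "\<exists>y. state_action A q (u @ [x]) = state_action A q u @ [y]"
  by (induction u arbitrary: q) auto

lemma state_automorphism_in_carrier:
  assumes q: "q \<in> states A"
  shows "state_automorphism A q \<in> carrier (TreeAutoGroup (alphabet A))"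
proof -
  let ?f = "state_action A q"
  have "bij_betw ?f (lists (alphabet A)) (lists (alphabet A))"
    unfolding bij_betw_def
  proof
    show "inj_on ?f (lists (alphabet A))"
      using state_action_inj[OF q] by (rule inj_onI)
    show "?f ` lists (alphabet A) = lists (alphabet A)"
    proof
      show "?f ` lists (alphabet A) \<subseteq> lists (alphabet A)"
        using state_action_closed[OF q] by (rule image_subsetI)
      show "lists (alphabet A) \<subseteq> ?f ` lists (alphabet A)"
      proof
        fix w assume "w \<in> lists (alphabet A)"
        from state_action_surj[OF q this] show "w \<in> ?f ` lists (alphabet A)"
          by (elim bexE) (simp add: rev_image_eqI)
      qed
    qed
  qed
  moreover have "(\<exists>x. v = u @ [x]) \<longleftrightarrow> (\<exists>x. ?f v = ?f u @ [x])"
    if uv: "u \<in> lists (alphabet A)" "v \<in> lists (alphabet A)" for u v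
  proof
    assume "\<exists>x. v = u @ [x]"
    then show "\<exists>x. ?f v = ?f u @ [x]" using state_action_append1 by auto
  next
    assume *: "\<exists>x. ?f v = ?f u @ [x]"
    then have "length v = length u + 1"
      by (metis length_append_singleton length_state_action Suc_eq_plus1)
    then have v: "v = butlast v @ [last v]" by (cases v) auto
    then obtain y where "?f v = ?f (butlast v) @ [y]" using state_action_append1 by metis
    then have "?f (butlast v) = ?f u" using * by auto
    moreover have "butlast v \<in> lists (alphabet A)"
      using uv(2) v by (metis append_in_lists_conv)
    ultimately have "butlast v = u" using state_action_inj[OF q] uv(1) by blast
    then show "\<exists>x. v = u @ [x]" using v by metis
  qed
  ultimately show ?thesis
    by (simp add: TreeAutoGroup_def tree_auto_def state_automorphism_def Bij_def bij_betw_def)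
qed

end

text \<open>The multiplicative monoid of \<open>R[[t]]\<close>, in the encoding used by \<^const>\<open>UP\<close>, so that
  polynomials are particular power series.\<close>

definition power_series_monoid :: "('a, 'm) ring_scheme \<Rightarrow> (nat \<Rightarrow> 'a) monoid" where
  "power_series_monoid R = \<lparr>
     carrier = UNIV \<rightarrow> carrier R,
     monoid.mult = (\<lambda>p q n. \<Oplus>\<^bsub>R\<^esub>i \<in> {..n}. p i \<otimes>\<^bsub>R\<^esub> q (n - i)),
     one = (\<lambda>i. if i = 0 then \<one>\<^bsub>R\<^esub> else \<zero>\<^bsub>R\<^esub>)\<rparr>"

text \<open>\<open>R\<^sup>d\<close> is the set of functions from \<open>{1..d}\<close> to \<open>R\<close>.\<close>

definition poly_automaton ::
  "('a, 'm) ring_scheme \<Rightarrow> nat \<Rightarrow> (nat \<Rightarrow> 'a) \<Rightarrow> (nat \<Rightarrow> 'a, 'a) automaton" where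
  "poly_automaton R d g = \<lparr>
     states = {1..d} \<rightarrow>\<^sub>E carrier R,
     alphabet = carrier R,
     rewriting = (\<lambda>y x. (\<Oplus>\<^bsub>R\<^esub>i \<in> {1..d}. coeff (UP R) g (d + 1 - i) \<otimes>\<^bsub>R\<^esub> y i)
                        \<oplus>\<^bsub>R\<^esub> coeff (UP R) g 0 \<otimes>\<^bsub>R\<^esub> x),
     transition = (\<lambda>y x. \<lambda>i\<in>{1..d}. if i < d then y (i + 1) else x)\<rparr>"

lemma (in cring) poly_automaton_invertible:
  assumes fin: "finite (carrier R)" and g: "g \<in> carrier (UP R)"
    and unit: "g \<in> Units (power_series_monoid R)"
  shows "invertible_automaton (poly_automaton R d g)"
proof -
  have coeff: "coeff (UP R) g i = g i" for i using g by (simp add: UP_def)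
  have g_in: "g i \<in> carrier R" for i using g by (auto simp: UP_def up_def)
  obtain h where h: "\<And>i. h i \<in> carrier R"
    and gh: "g \<otimes>\<^bsub>power_series_monoid R\<^esub> h = \<one>\<^bsub>power_series_monoid R\<^esub>"
    using unit by (auto simp: Units_def power_series_monoid_def)
  have inv0: "g 0 \<otimes> h 0 = \<one>"
    using fun_cong[OF gh, of 0] g_in h by (simp add: power_series_monoid_def)
  have sum_in: "(\<Oplus>i\<in>{1..d}. g (Suc d - i) \<otimes> y i) \<in> carrier R"
    if "y \<in> {1..d} \<rightarrow>\<^sub>E carrier R" for y
    using that g_in by (intro finsum_closed) auto
  show ?thesis
  proof
    show "finite (states (poly_automaton R d g))"
      using fin by (simp add: poly_automaton_def finite_PiE)
    show "finite (alphabet (poly_automaton R d g))"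
      using fin by (simp add: poly_automaton_def)
    show "rewriting (poly_automaton R d g) \<in> states (poly_automaton R d g) \<rightarrow>
        alphabet (poly_automaton R d g) \<rightarrow> alphabet (poly_automaton R d g)"
      using sum_in g_in by (simp add: poly_automaton_def coeff)
    show "transition (poly_automaton R d g) \<in> states (poly_automaton R d g) \<rightarrow>
        alphabet (poly_automaton R d g) \<rightarrow> states (poly_automaton R d g)"
      by (auto simp: poly_automaton_def PiE_iff)
  next
    fix y assume "y \<in> states (poly_automaton R d g)"
    then have y: "y \<in> {1..d} \<rightarrow>\<^sub>E carrier R" by (simp add: poly_automaton_def)
    define s where "s = (\<Oplus>i\<in>{1..d}. g (Suc d - i) \<otimes> y i)"
    have s: "s \<in> carrier R" using sum_in[OF y] by (simp add: s_def)
    have "bij_betw (\<lambda>x. s \<oplus> g 0 \<otimes> x) (carrier R) (carrier R)"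
    proof -
      have "inj_on (\<lambda>x. s \<oplus> g 0 \<otimes> x) (carrier R)"
      proof (rule inj_onI)
        fix x z assume x: "x \<in> carrier R" and z: "z \<in> carrier R"
          and "s \<oplus> g 0 \<otimes> x = s \<oplus> g 0 \<otimes> z"
        then have "g 0 \<otimes> x = g 0 \<otimes> z" using s g_in[of 0] by simp
        then have "h 0 \<otimes> (g 0 \<otimes> x) = h 0 \<otimes> (g 0 \<otimes> z)" by simp
        moreover have "h 0 \<otimes> g 0 = \<one>" using inv0 g_in[of 0] h[of 0] by (simp add: m_comm)
        ultimately show "x = z"
          using x z g_in[of 0] h[of 0] by (simp add: m_assoc[symmetric])
      qed
      moreover have "(\<lambda>x. s \<oplus> g 0 \<otimes> x) ` carrier R \<subseteq> carrier R"
        using s g_in[of 0] by auto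
      ultimately show ?thesis using fin by (simp add: bij_betw_def endo_inj_surj)
    qed
    then show "bij_betw (rewriting (poly_automaton R d g) y) (alphabet (poly_automaton R d g))
        (alphabet (poly_automaton R d g))"
      by (simp add: poly_automaton_def coeff s_def)
  qed
qed

definition semidirect_product ::
  "('a, 'm) monoid_scheme \<Rightarrow> ('b, 'n) monoid_scheme \<Rightarrow> ('b \<Rightarrow> 'a \<Rightarrow> 'a) \<Rightarrow> ('a \<times> 'b) monoid" where
  "semidirect_product G H \<phi> = \<lparr>
     carrier = carrier G \<times> carrier H,
     monoid.mult = (\<lambda>(x, h) (y, k). (x \<otimes>\<^bsub>G\<^esub> \<phi> h y, h \<otimes>\<^bsub>H\<^esub> k)),
     one = (\<one>\<^bsub>G\<^esub>, \<one>\<^bsub>H\<^esub>)\<rparr>"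

definition translation :: "int \<Rightarrow> (int \<Rightarrow> 'a) \<Rightarrow> int \<Rightarrow> 'a" where
  "translation k f = (\<lambda>i. f (i - k))"

definition lamplighter_group :: "nat \<Rightarrow> nat \<Rightarrow> ((int \<Rightarrow> nat \<Rightarrow> int) \<times> int) monoid" where
  "lamplighter_group n d =
     semidirect_product
       (sum_group UNIV (\<lambda>_::int. product_group {1..d} (\<lambda>_. add_monoid (residue_ring (int n)))))
       integer_group
       translation"

end

theory Submission
  imports "HOL-Computational_Algebra.Polynomial_FPS" Defs
begin

text \<open>
  Reading a word as a truncated power series \<open>F\<close> over \<open>\<int>/n\<close>, the automaton in state \<open>y\<close> computes
  the coefficients of \<open>g (Y + t\<^sup>d F)\<close> from \<open>t\<^sup>d\<close> on, where \<open>Y\<close> is the polynomial of degree \<open>< d\<close>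
  with coefficient vector \<open>y\<close>. So \<open>y\<close> acts as the affine map \<open>F \<mapsto> g F + o(y)\<close>, where \<open>o(y)\<close> is
  the quotient of \<open>g Y\<close> by \<open>t\<^sup>d\<close>, a polynomial with the degree and leading coefficient of \<open>Y\<close>
  since \<open>g\<close> is monic. The element \<open>(f, k)\<close> of the lamplighter group is sent to
  \<open>F \<mapsto> g\<^sup>k F + (\<Sum>i. g\<^sup>i o(f i))\<close>. This is a homomorphism because multiplying by \<open>g\<close> shifts the
  index \<open>i\<close>, and it is injective because expansions in base \<open>g\<close> are unique and no nontrivial power
  of \<open>g\<close> is \<open>1\<close>. The state \<open>y\<close> is the image of the lamp configuration \<open>y\<close> at \<open>0\<close> followed by a unit
  shift, and these elements generate the lamplighter group. As \<open>n\<close> is not a type, power series over \<open>\<int>/n\<close> are represented by integer power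
  series up to coefficientwise congruence.
\<close>

hide_const (open) Polynomial.coeff
unbundle fps_syntax

section \<open>Power series over Z/m as integer series up to congruence\<close>

definition fps_cong :: "int \<Rightarrow> int fps \<Rightarrow> int fps \<Rightarrow> bool" where
  "fps_cong m F G \<longleftrightarrow> (\<forall>i. [F $ i = G $ i] (mod m))"

lemma fps_cong_refl [simp]: "fps_cong m F F"
  by (simp add: fps_cong_def)

lemma fps_cong_sym: "fps_cong m F G \<Longrightarrow> fps_cong m G F"
  by (simp add: fps_cong_def cong_sym_eq)

lemma fps_cong_trans [trans]: "fps_cong m F G \<Longrightarrow> fps_cong m G H \<Longrightarrow> fps_cong m F H"
  unfolding fps_cong_def using cong_trans by blast

lemma fps_cong_add: "fps_cong m F F' \<Longrightarrow> fps_cong m G G' \<Longrightarrow> fps_cong m (F + G) (F' + G')"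
  by (simp add: fps_cong_def cong_add)

lemma fps_cong_mult: "fps_cong m F F' \<Longrightarrow> fps_cong m G G' \<Longrightarrow> fps_cong m (F * G) (F' * G')"
  unfolding fps_cong_def fps_mult_nth by (intro allI cong_sum cong_mult) auto

lemma fps_cong_sum:
  "(\<And>i. i \<in> S \<Longrightarrow> fps_cong m (F i) (G i)) \<Longrightarrow> fps_cong m (\<Sum>i\<in>S. F i) (\<Sum>i\<in>S. G i)"
  by (auto simp: fps_cong_def fps_sum_nth intro!: cong_sum)

lemma fps_cong_power: "fps_cong m F G \<Longrightarrow> fps_cong m (F ^ k) (G ^ k)"
  by (induction k) (auto intro: fps_cong_mult)

section \<open>Affine maps on words and tree automorphisms\<close>

definition word_fps :: "int list \<Rightarrow> int fps" where
  "word_fps w = Abs_fps (\<lambda>i. if i < length w then w ! i else 0)"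

text \<open>Words are padded with zeros to power series. Reduction modulo \<open>m\<close> puts the
  output into the alphabet \<open>{0..m - 1}\<close> and makes it depend on \<open>P\<close> and
  \<open>U\<close> only up to \<open>fps_cong\<close>.\<close>

definition affine_map :: "int \<Rightarrow> int fps \<Rightarrow> int fps \<Rightarrow> int list \<Rightarrow> int list" where
  "affine_map m P U w = map (\<lambda>i. (P * word_fps w + U) $ i mod m) [0..<length w]"

lemma length_affine_map [simp]: "length (affine_map m P U w) = length w"
  by (simp add: affine_map_def)

lemma nth_affine_map [simp]:
  "i < length w \<Longrightarrow> affine_map m P U w ! i = (P * word_fps w + U) $ i mod m"
  by (simp add: affine_map_def)

lemma affine_map_in_lists: "m > 0 \<Longrightarrow> affine_map m P U w \<in> lists {0..m - 1}"
  by (auto simp: affine_map_def)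

text \<open>Coefficient \<open>i\<close> of a product sees only the coefficients up to
  \<open>i\<close> of its factors, so neither padding nor truncating a word affects earlier output
  letters.\<close>

lemma fps_mult_nth_cong:
  assumes "\<And>j. j \<le> i \<Longrightarrow> [F $ j = F' $ j] (mod m)"
  shows "[(P * F) $ i = (P * F') $ i] (mod (m::int))"
  unfolding fps_mult_nth using assms by (intro cong_sum cong_mult) auto

lemma affine_map_cong:
  assumes "fps_cong m P P'" "fps_cong m U U'"
  shows "affine_map m P U w = affine_map m P' U' w"
proof (rule nth_equalityI)
  fix i assume "i < length (affine_map m P U w)"
  moreover have "fps_cong m (P * word_fps w + U) (P' * word_fps w + U')"
    using assms by (intro fps_cong_add fps_cong_mult) auto
  ultimately show "affine_map m P U w ! i = affine_map m P' U' w ! i"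
    by (simp add: fps_cong_def cong_def)
qed simp

text \<open>The inner word agrees with \<open>Q * word_fps w + V\<close> modulo \<open>m\<close>
  only below \<open>length w\<close>. This suffices because multiplication by \<open>P\<close> never
  carries later coefficients to earlier places.\<close>

lemma affine_map_compose:
  "affine_map m P U (affine_map m Q V w) = affine_map m (P * Q) (P * V + U) w"
proof (rule nth_equalityI)
  fix i assume "i < length (affine_map m P U (affine_map m Q V w))"
  then have i: "i < length w" by simp
  have "[(P * word_fps (affine_map m Q V w)) $ i = (P * (Q * word_fps w + V)) $ i] (mod m)"
    using i by (intro fps_mult_nth_cong) (simp add: word_fps_def)
  then have "[(P * word_fps (affine_map m Q V w) + U) $ i =
      (P * (Q * word_fps w + V) + U) $ i] (mod m)"
    by (simp add: cong_add)
  also have "P * (Q * word_fps w + V) + U = P * Q * word_fps w + (P * V + U)"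
    by (simp add: algebra_simps)
  finally show "affine_map m P U (affine_map m Q V w) ! i = affine_map m (P * Q) (P * V + U) w ! i"
    using i by (simp add: cong_def)
qed simp

lemma affine_map_id: "w \<in> lists {0..m - 1} \<Longrightarrow> affine_map m 1 0 w = w"
  by (rule nth_equalityI) (auto simp: word_fps_def in_lists_conv_set dest!: nth_mem)

lemma take_affine_map: "take k (affine_map m P U w) = affine_map m P U (take k w)"
proof (rule nth_equalityI)
  fix i assume "i < length (take k (affine_map m P U w))"
  then have i: "i < k" "i < length w" by auto
  have "[(P * word_fps w) $ i = (P * word_fps (take k w)) $ i] (mod m)"
    using i by (intro fps_mult_nth_cong) (simp add: word_fps_def)
  then have "[(P * word_fps w + U) $ i = (P * word_fps (take k w) + U) $ i] (mod m)"
    by (simp add: cong_add)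
  then show "take k (affine_map m P U w) ! i = affine_map m P U (take k w) ! i"
    using i by (simp add: cong_def)
qed simp

text \<open>Words of zeros of every length recover \<open>U\<close>, and words consisting of a 1
  followed by zeros recover \<open>P + U\<close>.\<close>

lemma affine_map_eq_id:
  assumes m: "m > 1" and eq: "\<And>w. w \<in> lists {0..m - 1} \<Longrightarrow> affine_map m P U w = w"
  shows "fps_cong m P 1 \<and> fps_cong m U 0"
proof -
  have U: "fps_cong m U 0"
    unfolding fps_cong_def
  proof
    fix i
    let ?w = "replicate (Suc i) (0::int)"
    have "affine_map m P U ?w ! i = 0"
      using m by (subst eq) (auto simp: nth_append simp del: replicate_Suc)
    moreover have "word_fps ?w = 0"
      by (rule fps_ext) (simp add: word_fps_def del: replicate_Suc)
    ultimately show "[U $ i = 0 $ i] (mod m)" by (simp add: cong_def del: replicate_Suc)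
  qed
  have "fps_cong m (P + U) 1"
    unfolding fps_cong_def
  proof
    fix i
    let ?w = "1 # replicate i (0::int)"
    have "affine_map m P U ?w ! i = ?w ! i"
      using m by (subst eq) auto
    moreover have "word_fps ?w = 1"
      by (rule fps_ext) (auto simp add: word_fps_def nth_Cons split: nat.splits)
    moreover have "?w ! i = 1 $ i"
      by (cases i) (simp_all del: replicate_Suc)
    ultimately show "[(P + U) $ i = 1 $ i] (mod m)"
      using m by (simp add: cong_def)
  qed
  moreover have "fps_cong m P (P + U)"
    using U by (simp add: fps_cong_def cong_iff_dvd_diff)
  ultimately show ?thesis using U fps_cong_trans by blast
qed

text \<open>The inverse of F -> P F + U is F -> Q F - Q U, which is again affine.\<close>

lemma affine_map_bij_betw:
  assumes m: "m > 0" and PQ: "fps_cong m (P * Q) 1"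
  shows "bij_betw (affine_map m P U) (lists {0..m - 1}) (lists {0..m - 1})"
proof (rule bij_betw_byWitness)
  show "\<forall>w\<in>lists {0..m - 1}. affine_map m Q (- Q * U) (affine_map m P U w) = w"
    using PQ by (auto simp: affine_map_compose mult.commute affine_map_id
        affine_map_cong[of m "P * Q" 1 "0" 0])
  have "fps_cong m (P * (- Q * U) + U) 0"
  proof -
    have "fps_cong m (P * Q * (- U) + U) (1 * (- U) + U)"
      using PQ by (intro fps_cong_add fps_cong_mult) auto
    then show ?thesis by (simp add: algebra_simps)
  qed
  then show "\<forall>w\<in>lists {0..m - 1}. affine_map m P U (affine_map m Q (- Q * U) w) = w"
    using affine_map_cong[OF PQ] by (simp add: affine_map_compose affine_map_id)
qed (use affine_map_in_lists[OF m] in blast)+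

text \<open>Affine maps preserve length and commute with \<open>take\<close>, so the parent relation
  of the tree is put in these terms.\<close>

lemma ex_append_singleton_iff:
  "(\<exists>x. v = u @ [x]) \<longleftrightarrow> length v = Suc (length u) \<and> take (length u) v = u"
proof
  assume "length v = Suc (length u) \<and> take (length u) v = u"
  then have "v = u @ [v ! length u]" 
    by (metis lessI order_refl take_Suc_conv_app_nth take_all)
  then show "\<exists>x. v = u @ [x]" ..
qed auto

lemma affine_map_tree_auto:
  assumes m: "m > 0" and PQ: "fps_cong m (P * Q) 1"
  shows "restrict (affine_map m P U) (lists {0..m - 1}) \<in> tree_auto {0..m - 1}"
proof -
  let ?L = "lists {0..m - 1}" and ?f = "affine_map m P U"
  have bij: "bij_betw ?f ?L ?L" using affine_map_bij_betw[OF assms] .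
  have "(\<exists>x. v = u @ [x]) \<longleftrightarrow> (\<exists>x. ?f v = ?f u @ [x])" if u: "u \<in> ?L" and v: "v \<in> ?L" for u v
  proof -
    have "take (length u) v \<in> ?L"
      using v by (auto simp: in_lists_conv_set dest: in_set_takeD)
    then have "?f (take (length u) v) = ?f u \<longleftrightarrow> take (length u) v = u"
      using bij u by (auto simp: bij_betw_def inj_on_def)
    then show ?thesis by (simp add: ex_append_singleton_iff take_affine_map)
  qed
  moreover have "?f [] = []" by (simp add: affine_map_def)
  moreover have "restrict ?f ?L \<in> Bij ?L"
    using bij by (simp add: Bij_def cong: bij_betw_cong)
  ultimately show ?thesis by (simp add: tree_auto_def)
qed

section \<open>Shifts and expansions in base \<open>G\<close>\<close>

lemma fps_cong_shift: "fps_cong m F G \<Longrightarrow> fps_cong m (fps_shift k F) (fps_shift k G)"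
  by (simp add: fps_cong_def)

text \<open>All terms before the last have degree below \<open>N * degree G\<close>, so the leading
  coefficient of a nonzero last digit is a coefficient of the whole sum. Being divisible by
  \<open>m\<close> and in \<open>{0..<m}\<close>, it is 0. The range condition concerns leading
  coefficients because the digits used later are quotients of integer products, whose other
  coefficients need not be reduced.\<close>

lemma base_expansion_unique:
  fixes G :: "int poly" and P :: "nat \<Rightarrow> int poly"
  assumes monic: "lead_coeff G = 1"
    and deg: "\<And>i. i \<le> N \<Longrightarrow> degree (P i) < degree G"
    and lead: "\<And>i. i \<le> N \<Longrightarrow> lead_coeff (P i) \<in> {0..<m}"
    and zero: "\<And>j. m dvd Polynomial.coeff (\<Sum>i\<le>N. G ^ i * P i) j"
    and i: "i \<le> N"
  shows "P i = 0"
proof -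
  have eq_0: "x = 0" if "m dvd x" "x \<in> {0..<m}" for x :: int
    using that by (auto dest: zdvd_imp_le)
  show ?thesis
    using deg lead zero i
  proof (induction N arbitrary: i)
    case 0
    then have "m dvd lead_coeff (P 0)" "lead_coeff (P 0) \<in> {0..<m}" by auto
    then have "lead_coeff (P 0) = 0" by (metis eq_0)
    then show ?case using 0 by simp
  next
    case (Suc N)
    let ?d = "degree G"
    have G: "G \<noteq> 0" using monic by auto
    have "P (Suc N) = 0"
    proof (rule ccontr)
      assume nz: "P (Suc N) \<noteq> 0"
      let ?k = "Suc N * ?d + degree (P (Suc N))"
      have "degree (G ^ Suc N * P (Suc N)) = ?k"
        using nz G by (simp add: degree_mult_eq degree_power_eq del: power_Suc)
      then have "Polynomial.coeff (G ^ Suc N * P (Suc N)) ?k = lead_coeff (P (Suc N))"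
        using monic by (metis lead_coeff_mult lead_coeff_power mult_1 power_one)
      moreover have "Polynomial.coeff (G ^ i * P i) ?k = 0" if "i \<le> N" for i
      proof (rule coeff_eq_0)
        have "degree (G ^ i * P i) \<le> i * ?d + degree (P i)"
          by (metis degree_mult_le degree_power_le add_le_mono1 le_trans mult.commute)
        also have "\<dots> < Suc i * ?d" using Suc.prems(1)[of i] that by simp
        also have "\<dots> \<le> Suc N * ?d" using that by (intro mult_le_mono1) simp
        finally show "degree (G ^ i * P i) < ?k" by simp
      qed
      ultimately have "Polynomial.coeff (\<Sum>i\<le>Suc N. G ^ i * P i) ?k = lead_coeff (P (Suc N))"
        by (simp add: coeff_sum del: power_Suc)
      then have "m dvd lead_coeff (P (Suc N))" using Suc.prems(3)[of ?k] by simp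
      moreover have "lead_coeff (P (Suc N)) \<in> {0..<m}" using Suc.prems(2)[of "Suc N"] by simp
      ultimately have "lead_coeff (P (Suc N)) = 0" by (metis eq_0)
      then show False using nz by simp
    qed
    moreover from this have "P i = 0" if "i \<le> N" for i
      using Suc.prems that by (intro Suc.IH) auto
    ultimately show ?case using Suc.prems(4) by (cases "i = Suc N") auto
  qed
qed

text \<open>Multiplying by the monic \<open>G\<close> raises the degree by \<open>degree G\<close>
  and keeps the leading coefficient; dropping the \<open>degree G\<close> lowest coefficients undoes
  the change of degree.\<close>

lemma degree_lead_coeff_poly_shift:
  fixes G P :: "int poly"
  assumes "lead_coeff G = 1"
  shows "degree (poly_shift (degree G) (G * P)) = degree P"
    and "lead_coeff (poly_shift (degree G) (G * P)) = lead_coeff P"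
proof -
  let ?Q = "poly_shift (degree G) (G * P)"
  have G: "G \<noteq> 0" using assms by auto
  have top: "Polynomial.coeff ?Q (degree P) = lead_coeff P"
    using assms by (simp add: coeff_poly_shift coeff_mult_degree_sum add.commute)
  have "degree ?Q \<le> degree P"
  proof (rule degree_le, intro allI impI)
    fix i assume "degree P < i"
    then have "degree (G * P) < i + degree G"
      using degree_mult_le[of G P] by linarith
    then show "Polynomial.coeff ?Q i = 0"
      by (simp add: coeff_poly_shift coeff_eq_0)
  qed
  moreover have "degree P \<le> degree ?Q"
    using top by (cases "P = 0") (auto intro: le_degree)
  ultimately show "degree ?Q = degree P" by simp
  then show "lead_coeff ?Q = lead_coeff P" using top by simp
qed

section \<open>Lamp configurations as expansions in base \<open>G\<close>\<close>

lemma Collect_diff_eq_image: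
  fixes k :: int
  shows "{i. Q (i - k)} = (\<lambda>i. i + k) ` {i. Q i}"
proof
  show "{i. Q (i - k)} \<subseteq> (\<lambda>i. i + k) ` {i. Q i}"
  proof
    fix i assume "i \<in> {i. Q (i - k)}"
    then show "i \<in> (\<lambda>i. i + k) ` {i. Q i}" by (intro image_eqI[of _ _ "i - k"]) auto
  qed
qed auto

text \<open>States are indexed from 1 and coefficients from 0, hence \<open>Suc j\<close>. The
  oldest letter \<open>y 1\<close> of a state is the constant term.\<close>

definition digit_poly :: "nat \<Rightarrow> (nat \<Rightarrow> int) \<Rightarrow> int poly" where
  "digit_poly d y = (\<Sum>j<d. Polynomial.monom (y (Suc j)) j)"

lemma coeff_digit_poly: "Polynomial.coeff (digit_poly d y) j = (if j < d then y (Suc j) else 0)"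
  by (simp add: digit_poly_def coeff_sum)

lemma degree_digit_poly: "d > 0 \<Longrightarrow> degree (digit_poly d y) < d"
  by (rule degree_lessI) (auto simp: coeff_digit_poly)

text \<open>\<open>G\<close> lifts g to the integers and \<open>h\<close> represents the inverse of
  g over Z/m, so their product is 1 only up to congruence.\<close>

locale invertible_monic =
  fixes m :: int and d :: nat and G :: "int poly" and h :: "int fps"
  assumes m: "m > 1" and d: "d > 0"
    and degree: "degree G = d" and monic: "lead_coeff G = 1"
    and inverse: "fps_cong m (fps_of_poly G * h) 1"
begin

definition int_pow :: "int \<Rightarrow> int fps" where
  "int_pow k = (if k \<ge> 0 then fps_of_poly G ^ nat k else h ^ nat (- k))"

definition offset :: "(nat \<Rightarrow> int) \<Rightarrow> int fps" where
  "offset y = fps_shift d (fps_of_poly (G * digit_poly d y))"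

text \<open>This is the identity of (Z/m)^d in the encoding by extensional functions, so a lamp is
  off exactly when it equals \<open>zero_vec\<close>.\<close>

definition zero_vec :: "nat \<Rightarrow> int" where
  "zero_vec = (\<lambda>i\<in>{1..d}. 0)"

abbreviation vectors :: "(nat \<Rightarrow> int) set" where
  "vectors \<equiv> {1..d} \<rightarrow>\<^sub>E {0..m - 1}"

text \<open>The series with base-g digits \<open>offset (f i)\<close>. For infinite support the sum
  is 0 by convention; the lemmas about it assume finite support.\<close>

definition offset_sum :: "(int \<Rightarrow> nat \<Rightarrow> int) \<Rightarrow> int fps" where
  "offset_sum f = (\<Sum>i | f i \<noteq> zero_vec. int_pow i * offset (f i))"

text \<open>Pairs of \<open>G\<close> and \<open>h\<close> cancel modulo \<open>m\<close>. With
  exponents written as differences of naturals, additivity of exponents follows without a case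
  distinction on signs.\<close>

lemma int_pow_diff:
  "fps_cong m (int_pow (int a - int b)) (fps_of_poly G ^ a * h ^ b)"
proof (cases "b \<le> a")
  case True
  have "fps_cong m (fps_of_poly G ^ (a - b) * (fps_of_poly G * h) ^ b) (fps_of_poly G ^ (a - b) * 1 ^ b)"
    by (intro fps_cong_mult fps_cong_power inverse) simp
  moreover have "fps_of_poly G ^ (a - b) * (fps_of_poly G * h) ^ b = fps_of_poly G ^ a * h ^ b"
    using True by (simp add: power_mult_distrib mult.assoc[symmetric] flip: power_add)
  moreover have "int_pow (int a - int b) = fps_of_poly G ^ (a - b)"
    using True by (simp add: int_pow_def nat_diff_distrib)
  ultimately show ?thesis by (simp add: fps_cong_sym)
next
  case False
  have "fps_cong m (h ^ (b - a) * (fps_of_poly G * h) ^ a) (h ^ (b - a) * 1 ^ a)"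
    by (intro fps_cong_mult fps_cong_power inverse) simp
  moreover have "h ^ (b - a) * (fps_of_poly G * h) ^ a = fps_of_poly G ^ a * (h ^ (b - a) * h ^ a)"
    by (simp add: power_mult_distrib mult_ac)
  moreover have "h ^ (b - a) * h ^ a = h ^ b"
    using False by (simp flip: power_add)
  moreover have "int_pow (int a - int b) = h ^ (b - a)"
    using False by (simp add: int_pow_def nat_diff_distrib)
  ultimately show ?thesis by (simp add: fps_cong_sym)
qed

lemma int_pow_add: "fps_cong m (int_pow (j + k)) (int_pow j * int_pow k)"
proof -
  obtain a b a' b' :: nat where j: "j = int a - int b" and k: "k = int a' - int b'"
    by (metis int_diff_cases)
  have "fps_cong m (int_pow (j + k)) (fps_of_poly G ^ (a + a') * h ^ (b + b'))"
    using int_pow_diff[of "a + a'" "b + b'"] by (simp add: j k algebra_simps)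
  also have "fps_of_poly G ^ (a + a') * h ^ (b + b') =
      (fps_of_poly G ^ a * h ^ b) * (fps_of_poly G ^ a' * h ^ b')"
    by (simp add: power_add mult_ac)
  also have "fps_cong m \<dots> (int_pow j * int_pow k)"
    unfolding j k by (intro fps_cong_mult fps_cong_sym[OF int_pow_diff])
  finally show ?thesis .
qed

lemma int_pow_0 [simp]: "int_pow 0 = 1"
  and int_pow_1 [simp]: "int_pow 1 = fps_of_poly G"
  by (simp_all add: int_pow_def)

lemma int_pow_inverse: "fps_cong m (int_pow k * int_pow (- k)) 1"
  using fps_cong_sym[OF int_pow_add[of k "- k"]] by simp

text \<open>For l = |k| > 0 the polynomial \<open>G ^ l\<close> is monic of degree
  \<open>l * d\<close> > 0, and its top coefficient 1 differs modulo \<open>m\<close> from that of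
  the series 1. A negative exponent is turned into a positive one by multiplying with the inverse
  power.\<close>

lemma int_pow_cong_1:
  assumes "fps_cong m (int_pow k) 1"
  shows "k = 0"
proof (rule ccontr)
  assume "k \<noteq> 0"
  define l where "l = nat \<bar>k\<bar>"
  have l: "l > 0" using \<open>k \<noteq> 0\<close> by (simp add: l_def)
  have "fps_cong m (fps_of_poly G ^ l) 1"
  proof (cases "k \<ge> 0")
    case True
    then show ?thesis using assms by (simp add: int_pow_def l_def)
  next
    case False
    then have "fps_of_poly G ^ l = int_pow (- k)" by (simp add: int_pow_def l_def)
    moreover have "fps_cong m (1 * int_pow (- k)) (int_pow k * int_pow (- k))"
      by (intro fps_cong_mult fps_cong_sym[OF assms]) simp
    ultimately show ?thesis using int_pow_inverse fps_cong_trans by (metis mult_1)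
  qed
  then have "[fps_of_poly (G ^ l) $ (l * d) = 1 $ (l * d)] (mod m)"
    unfolding fps_cong_def fps_of_poly_power by blast
  moreover have "Polynomial.coeff (G ^ l) (l * d) = 1"
  proof -
    have "degree (G ^ l) = l * d" using degree d by (subst degree_power_eq) auto
    then show ?thesis using monic lead_coeff_power[of G l] by simp
  qed
  ultimately have "[1 = 0] (mod m)" using l d by simp
  then show False using m by (simp add: cong_def)
qed

lemma offset_eq_fps_of_poly: "offset y = fps_of_poly (poly_shift d (G * digit_poly d y))"
  by (rule fps_ext) (simp add: offset_def coeff_poly_shift)

lemma digit_poly_eq_0_iff:
  assumes "y \<in> vectors"
  shows "digit_poly d y = 0 \<longleftrightarrow> y = zero_vec"
proof
  assume 0: "digit_poly d y = 0"
  have "y i = 0" if "i \<in> {1..d}" for i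
    using arg_cong[OF 0, of "\<lambda>p. Polynomial.coeff p (i - 1)"] that
    by (auto simp: coeff_digit_poly split: if_splits)
  then show "y = zero_vec" using assms by (auto simp: zero_vec_def PiE_def extensional_def)
qed (simp add: digit_poly_def zero_vec_def)

lemma lead_coeff_digit_poly: "y \<in> vectors \<Longrightarrow> lead_coeff (digit_poly d y) \<in> {0..<m}"
  using m by (auto simp: coeff_digit_poly PiE_iff)

lemma offset_zero [simp]: "offset zero_vec = 0"
  by (simp add: offset_def digit_poly_def zero_vec_def)

lemma offset_add:
  "fps_cong m (offset (\<lambda>j\<in>{1..d}. (y j + z j) mod m)) (offset y + offset z)"
proof -
  have "fps_cong m (fps_of_poly (digit_poly d (\<lambda>j\<in>{1..d}. (y j + z j) mod m)))
      (fps_of_poly (digit_poly d y + digit_poly d z))"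
    by (auto simp: fps_cong_def coeff_digit_poly)
  then have "fps_cong m (offset (\<lambda>j\<in>{1..d}. (y j + z j) mod m))
     (fps_shift d (fps_of_poly G * fps_of_poly (digit_poly d y + digit_poly d z)))"
    unfolding offset_def fps_of_poly_mult by (intro fps_cong_shift fps_cong_mult) auto
  also have "fps_shift d (fps_of_poly G * fps_of_poly (digit_poly d y + digit_poly d z)) =
      offset y + offset z"
    by (simp add: offset_def fps_of_poly_mult fps_of_poly_add distrib_left fps_shift_add)
  finally show ?thesis .
qed

lemma offset_sum_eq:
  assumes "finite S" "{i. f i \<noteq> zero_vec} \<subseteq> S"
  shows "offset_sum f = (\<Sum>i\<in>S. int_pow i * offset (f i))"
  unfolding offset_sum_def by (rule sum.mono_neutral_left) (use assms in auto)

text \<open>Reindexing by i + k turns a translation into the factor g^k. This matches the action of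
  Z in the semidirect product with the action of linear parts on offsets.\<close>

lemma offset_sum_translation:
  assumes "finite {i. f i \<noteq> zero_vec}"
  shows "fps_cong m (offset_sum (translation k f)) (int_pow k * offset_sum f)"
proof -
  have "{i. f (i - k) \<noteq> zero_vec} = (\<lambda>i. i + k) ` {i. f i \<noteq> zero_vec}"
    by (rule Collect_diff_eq_image)
  then have "offset_sum (translation k f) =
      (\<Sum>i\<in>(\<lambda>i. i + k) ` {i. f i \<noteq> zero_vec}. int_pow i * offset (f (i - k)))"
    unfolding offset_sum_def by (simp add: translation_def)
  also have "\<dots> = (\<Sum>i | f i \<noteq> zero_vec. int_pow (k + i) * offset (f i))"
    by (subst sum.reindex) (auto simp: inj_on_def add.commute)
  also have "fps_cong m \<dots> (\<Sum>i | f i \<noteq> zero_vec. int_pow k * int_pow i * offset (f i))"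
    by (intro fps_cong_sum fps_cong_mult int_pow_add) simp
  also have "\<dots> = int_pow k * offset_sum f"
    by (simp add: offset_sum_def sum_distrib_left mult.assoc)
  finally show ?thesis .
qed

lemma offset_sum_add:
  assumes "finite {i. f i \<noteq> zero_vec}" "finite {i. f' i \<noteq> zero_vec}"
  shows "fps_cong m (offset_sum (\<lambda>i. \<lambda>j\<in>{1..d}. (f i j + f' i j) mod m))
    (offset_sum f + offset_sum f')"
proof -
  \<comment> \<open>The three supports differ, and digits may cancel modulo \<open>m\<close>; over a
    common finite set the sums can be added term by term.\<close>
  define S where "S = {i. f i \<noteq> zero_vec} \<union> {i. f' i \<noteq> zero_vec}"
  define F where "F i = (\<lambda>j\<in>{1..d}. (f i j + f' i j) mod m)" for i
  have S: "finite S" using assms by (simp add: S_def)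
  have "F i = zero_vec" if "i \<notin> S" for i
  proof -
    have "f i = zero_vec" "f' i = zero_vec" using that by (simp_all add: S_def)
    then show ?thesis by (intro ext) (simp add: zero_vec_def F_def)
  qed
  then have F: "offset_sum F = (\<Sum>i\<in>S. int_pow i * offset (F i))"
    by (intro offset_sum_eq[OF S]) auto
  have "fps_cong m (\<Sum>i\<in>S. int_pow i * offset (F i))
      (\<Sum>i\<in>S. int_pow i * (offset (f i) + offset (f' i)))"
    unfolding F_def by (intro fps_cong_sum fps_cong_mult offset_add fps_cong_refl)
  moreover have "offset_sum f = (\<Sum>i\<in>S. int_pow i * offset (f i))"
    "offset_sum f' = (\<Sum>i\<in>S. int_pow i * offset (f' i))"
    by (rule offset_sum_eq[OF S]; simp add: S_def)+
  ultimately have "fps_cong m (offset_sum F) (offset_sum f + offset_sum f')"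
    by (simp add: F distrib_left sum.distrib)
  then show ?thesis unfolding F_def .
qed

text \<open>Multiplying by a large power of g clears the negative exponents and leaves a polynomial
  expansion in base \<open>G\<close>, whose digits vanish by uniqueness.\<close>

lemma offset_sum_cong_0:
  assumes fin: "finite {i. f i \<noteq> zero_vec}" and f: "\<And>i. f i \<in> vectors"
    and zero: "fps_cong m (offset_sum f) 0"
  shows "f i = zero_vec"
proof -
  obtain b where b: "\<And>i. f i \<noteq> zero_vec \<Longrightarrow> \<bar>i\<bar> \<le> b"
  proof -
    have "finite (abs ` {i. f i \<noteq> zero_vec})" using fin by simp
    then show ?thesis using that[of "Max (abs ` {i. f i \<noteq> zero_vec})"] by simp
  qed
  \<comment> \<open>For empty support \<open>Max\<close> is unspecified and \<open>b\<close> may be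
    negative; \<open>nat b\<close> is a valid bound in every case.\<close>
  define N where "N = nat b"
  define P where "P j = poly_shift d (G * digit_poly d (f (int j - int N)))" for j :: nat
  have supp: "f i \<noteq> zero_vec \<Longrightarrow> \<bar>i\<bar> \<le> int N" for i using b[of i] by (auto simp: N_def)
  have "fps_cong m (int_pow (int N) * offset_sum f) (int_pow (int N) * 0)"
    by (intro fps_cong_mult zero) simp
  then have "fps_cong m (int_pow (int N) * offset_sum f) 0" by simp
  from fps_cong_trans[OF offset_sum_translation[OF fin] this]
  have "fps_cong m (offset_sum (translation (int N) f)) 0" .
  moreover have "offset_sum (translation (int N) f) =
      (\<Sum>i\<in>int ` {..2 * N}. int_pow i * offset (f (i - int N)))"
  proof (subst offset_sum_eq)
    show "{i. translation (int N) f i \<noteq> zero_vec} \<subseteq> int ` {..2 * N}"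
    proof
      fix i assume "i \<in> {i. translation (int N) f i \<noteq> zero_vec}"
      then have "\<bar>i - int N\<bar> \<le> int N" using supp by (simp add: translation_def)
      then have "i = int (nat i)" "nat i \<le> 2 * N" by auto
      then show "i \<in> int ` {..2 * N}" by blast
    qed
  qed (simp_all add: translation_def)
  moreover have "\<dots> = fps_of_poly (\<Sum>j\<le>2 * N. G ^ j * P j)"
    by (subst sum.reindex) (auto simp: int_pow_def P_def offset_eq_fps_of_poly
        fps_of_poly_sum fps_of_poly_mult fps_of_poly_power intro!: sum.cong)
  ultimately have *: "fps_cong m (fps_of_poly (\<Sum>j\<le>2 * N. G ^ j * P j)) 0" by simp
  have "P j = 0" if "j \<le> 2 * N" for j
  proof (rule base_expansion_unique[OF monic, of "2 * N" P m])
    show "degree (P j) < degree G" "lead_coeff (P j) \<in> {0..<m}" for j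
      using degree_lead_coeff_poly_shift[OF monic] degree_digit_poly[OF d] lead_coeff_digit_poly[OF f]
      by (simp_all add: P_def degree)
    show "m dvd Polynomial.coeff (\<Sum>i\<le>2 * N. G ^ i * P i) j" for j
      using * by (simp add: fps_cong_def cong_0_iff)
  qed (fact that)
  \<comment> \<open>The leading coefficient of the digit polynomial survives in \<open>P j\<close>,
    so \<open>P j = 0\<close> forces the digit polynomial to be 0.\<close>
  moreover have "f (int j - int N) = zero_vec" if "P j = 0" for j
    using degree_lead_coeff_poly_shift(2)[OF monic, of "digit_poly d (f (int j - int N))"] that
      digit_poly_eq_0_iff[OF f] by (simp add: P_def degree)
  ultimately have **: "f (int j - int N) = zero_vec" if "j \<le> 2 * N" for j using that by blast
  show ?thesis
  proof (rule ccontr)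
    assume "f i \<noteq> zero_vec"
    moreover from this have "\<bar>i\<bar> \<le> int N" by (rule supp)
    ultimately have "int (nat (i + int N)) - int N = i" "nat (i + int N) \<le> 2 * N" by auto
    then show False using **[of "nat (i + int N)"] \<open>f i \<noteq> zero_vec\<close> by simp
  qed
qed

end

section \<open>The lamplighter group in explicit form\<close>

lemma semidirect_product_group:
  assumes G: "group G" and H: "group H"
    and hom: "\<And>h. h \<in> carrier H \<Longrightarrow> \<phi> h \<in> hom G G"
    and one: "\<And>x. x \<in> carrier G \<Longrightarrow> \<phi> \<one>\<^bsub>H\<^esub> x = x"
    and mult: "\<And>h k x. h \<in> carrier H \<Longrightarrow> k \<in> carrier H \<Longrightarrow> x \<in> carrier G \<Longrightarrow>
      \<phi> (h \<otimes>\<^bsub>H\<^esub> k) x = \<phi> h (\<phi> k x)"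
  shows "group (semidirect_product G H \<phi>)"
proof -
  interpret G: group G by (rule G)
  interpret H: group H by (rule H)
  have closed: "\<phi> h x \<in> carrier G" if "h \<in> carrier H" "x \<in> carrier G" for h x
    using hom_in_carrier[OF hom] that .
  have distr: "\<phi> h (x \<otimes>\<^bsub>G\<^esub> y) = \<phi> h x \<otimes>\<^bsub>G\<^esub> \<phi> h y"
    if "h \<in> carrier H" "x \<in> carrier G" "y \<in> carrier G" for h x y
    using hom_mult[OF hom] that .
  have \<phi>_one: "\<phi> h \<one>\<^bsub>G\<^esub> = \<one>\<^bsub>G\<^esub>" if "h \<in> carrier H" for h
    using hom_one[OF hom[OF that] G G] .
  show ?thesis
  proof (rule groupI)
    fix p assume "p \<in> carrier (semidirect_product G H \<phi>)"
    then obtain x h where p: "p = (x, h)" "x \<in> carrier G" "h \<in> carrier H"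
      by (auto simp: semidirect_product_def)
    have "\<phi> (inv\<^bsub>H\<^esub> h) (inv\<^bsub>G\<^esub> x) \<otimes>\<^bsub>G\<^esub> \<phi> (inv\<^bsub>H\<^esub> h) x = \<one>\<^bsub>G\<^esub>"
      using p by (simp add: distr[symmetric] \<phi>_one)
    then show "\<exists>q\<in>carrier (semidirect_product G H \<phi>).
        q \<otimes>\<^bsub>semidirect_product G H \<phi>\<^esub> p = \<one>\<^bsub>semidirect_product G H \<phi>\<^esub>"
      using p closed
      by (intro bexI[of _ "(\<phi> (inv\<^bsub>H\<^esub> h) (inv\<^bsub>G\<^esub> x), inv\<^bsub>H\<^esub> h)"]) (auto simp: semidirect_product_def)
  qed (auto simp: semidirect_product_def closed distr one mult G.m_assoc H.m_assoc)
qed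

lemma group_add_residue_ring: "m > 1 \<Longrightarrow> group (add_monoid (residue_ring m))"
  using abelian_group.a_group[OF residues.abelian_group[OF residues.intro]] .

lemma group_lamplighter_summands:
  "n > 1 \<Longrightarrow> group (product_group {1..d} (\<lambda>_. add_monoid (residue_ring (int n))))"
  by (intro product_group group_add_residue_ring) simp

lemma group_lamplighter_group:
  assumes "n > 1"
  shows "group (lamplighter_group n d)"
  unfolding lamplighter_group_def
proof (rule semidirect_product_group)
  let ?V = "\<lambda>_::int. product_group {1..d} (\<lambda>_. add_monoid (residue_ring (int n)))"
  have V: "\<And>i. group (?V i)" using group_lamplighter_summands[OF assms] .
  show "group (sum_group UNIV ?V)" by (rule sum_group) (rule V)
  fix k :: int
  show "translation k \<in> hom (sum_group UNIV ?V) (sum_group UNIV ?V)"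
  proof (rule homI)
    fix f assume "f \<in> carrier (sum_group UNIV ?V)"
    then have f: "f \<in> (\<Pi>\<^sub>E i\<in>UNIV. carrier (?V i))" "finite {i. f i \<noteq> \<one>\<^bsub>?V i\<^esub>}"
      using carrier_sum_group[of UNIV ?V] V by simp_all
    have "{i. f (i - k) \<noteq> \<one>\<^bsub>?V i\<^esub>} = (\<lambda>i. i + k) ` {i. f i \<noteq> \<one>\<^bsub>?V i\<^esub>}"
      using Collect_diff_eq_image[of "\<lambda>i. f i \<noteq> \<one>\<^bsub>?V 0\<^esub>" k] by simp
    then have "finite {i. f (i - k) \<noteq> \<one>\<^bsub>?V i\<^esub>}" using f(2) by simp
    then show "translation k f \<in> carrier (sum_group UNIV ?V)"
      using carrier_sum_group[of UNIV ?V] V f(1) by (simp add: translation_def PiE_iff)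
  qed (simp add: translation_def restrict_UNIV)
qed (auto simp: translation_def algebra_simps)

lemma carrier_lamplighter_group:
  assumes "n > 1"
  shows "carrier (lamplighter_group n d) =
    {(f, k). (\<forall>i. f i \<in> {1..d} \<rightarrow>\<^sub>E {0..int n - 1}) \<and> finite {i. f i \<noteq> (\<lambda>j\<in>{1..d}. 0)}}"
proof -
  let ?V = "\<lambda>_::int. product_group {1..d} (\<lambda>_. add_monoid (residue_ring (int n)))"
  have "carrier (sum_group UNIV ?V) = {x \<in> \<Pi>\<^sub>E i\<in>UNIV. carrier (?V i). finite {i \<in> UNIV. x i \<noteq> \<one>\<^bsub>?V i\<^esub>}}"
    by (rule carrier_sum_group) (rule group_lamplighter_summands[OF assms])
  then show ?thesis
    by (auto simp: lamplighter_group_def semidirect_product_def residue_ring_def PiE_iff)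
qed

lemma mult_lamplighter_group:
  "(f, k) \<otimes>\<^bsub>lamplighter_group n d\<^esub> (f', k') =
    (\<lambda>i. \<lambda>j\<in>{1..d}. (f i j + translation k f' i j) mod int n, k + k')"
  by (simp add: lamplighter_group_def semidirect_product_def residue_ring_def restrict_UNIV)

lemma one_lamplighter_group:
  "\<one>\<^bsub>lamplighter_group n d\<^esub> = (\<lambda>i. \<lambda>j\<in>{1..d}. 0, 0)"
  by (simp add: lamplighter_group_def semidirect_product_def residue_ring_def restrict_UNIV)

section \<open>The automaton acts by affine maps\<close>

lemma (in residues) finsum_eq_sum_mod:
  assumes "finite S" "f ` S \<subseteq> carrier R"
  shows "finsum R f S = (\<Sum>i\<in>S. f i) mod m"
proof -
  interpret cring R by (rule cring)
  show ?thesis using assms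
  proof (induction S rule: finite_induct)
    case empty
    then show ?case by (simp add: res_zero_eq)
  next
    case (insert x S)
    then have "finsum R f (insert x S) = f x \<oplus> finsum R f S" by (intro finsum_insert) auto
    then show ?case using insert by (simp add: res_add_eq mod_add_right_eq)
  qed
qed

text \<open>In \<open>?E y w\<close> the state fills the first \<open>d\<close> coefficients and the
  input follows. Reading a letter slides this window by one place. As \<open>G\<close> has degree
  \<open>d\<close>, coefficient i + d of the product involves only coefficients i to i + d of
  \<open>?E y w\<close>, so letters that left the state have no influence.\<close>

lemma poly_automaton_action:
  fixes G :: "int poly"
  assumes m: "m > 1" and d: "d \<ge> 1" and g: "g \<in> carrier (UP (residue_ring m))"
    and coeffs: "\<And>i. Polynomial.coeff G i = g i" and degree: "degree G = d"
    and y: "y \<in> {1..d} \<rightarrow>\<^sub>E {0..m - 1}" and w: "w \<in> lists {0..m - 1}"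
  shows "state_action (poly_automaton (residue_ring m) d g) y w =
    affine_map m (fps_of_poly G) (fps_shift d (fps_of_poly (G * digit_poly d y))) w"
proof -
  interpret residues m "residue_ring m" using m by unfold_locales simp
  let ?A = "poly_automaton (residue_ring m) d g"
  let ?E = "\<lambda>y w. fps_of_poly (digit_poly d y) + fps_X ^ d * word_fps w"
  have E: "?E y w $ j = (if j < d then y (Suc j) else if j < d + length w then w ! (j - d) else 0)"
    for y w j
    by (auto simp: coeff_digit_poly fps_X_power_mult_nth word_fps_def)
  \<comment> \<open>Coefficient \<open>d\<close> sees the state and the next letter
    \<open>x\<close>, whatever word \<open>w\<close> follows.\<close>
  have rewriting: "rewriting ?A y x = (fps_of_poly G * ?E y (x # w)) $ d mod m"
    if y: "y \<in> {1..d} \<rightarrow>\<^sub>E {0..m - 1}" for y x w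
  proof -
    have "(fps_of_poly G * ?E y (x # w)) $ d = (\<Sum>i=0..d. g (d - i) * ?E y (x # w) $ i)"
      by (subst mult.commute) (simp add: fps_mult_nth coeffs mult.commute[of "g _"] del: fps_add_nth)
    also have "\<dots> = (\<Sum>i<d. g (d - i) * y (Suc i)) + g 0 * x"
      unfolding E atLeast0AtMost lessThan_Suc_atMost[symmetric] by (simp add: sum.lessThan_Suc)
    \<comment> \<open>\<open>Suc\<close> passes from coefficient indices to state indices, which
      produces the \<open>d + 1 - i\<close> of the automaton.\<close>
    also have "(\<Sum>i<d. g (d - i) * y (Suc i)) = (\<Sum>i\<in>{1..d}. g (d + 1 - i) * y i)"
      by (rule sum.reindex_bij_witness[of _ "\<lambda>i. i - 1" Suc]) auto
    finally have *: "(fps_of_poly G * ?E y (x # w)) $ d =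
      (\<Sum>i\<in>{1..d}. g (d + 1 - i) * y i) + g 0 * x" .
    have "(\<Oplus>\<^bsub>residue_ring m\<^esub>i\<in>{1..d}. g (d + 1 - i) \<otimes>\<^bsub>residue_ring m\<^esub> y i) =
        (\<Sum>i\<in>{1..d}. (g (d + 1 - i) * y i) mod m) mod m"
      using m by (subst finsum_eq_sum_mod) (auto simp: residue_ring_def)
    also have "\<dots> = (\<Sum>i\<in>{1..d}. g (d + 1 - i) * y i) mod m"
      by (rule mod_sum_eq)
    finally show ?thesis
      using g unfolding * by (simp add: poly_automaton_def UP_def residue_ring_def mod_add_eq)
  qed
  have nth: "state_action ?A y w ! i = (fps_of_poly G * ?E y w) $ (i + d) mod m"
    if "i < length w" "y \<in> {1..d} \<rightarrow>\<^sub>E {0..m - 1}" "w \<in> lists {0..m - 1}" for i y w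
    using that
  proof (induction w arbitrary: y i)
    case (Cons x w)
    show ?case
    proof (cases i)
      case 0
      then show ?thesis using rewriting[OF Cons.prems(2), of x w] by simp
    next
      case (Suc k)
      let ?y = "transition ?A y x"
      have y': "?y = (\<lambda>i\<in>{1..d}. if i < d then y (i + 1) else x)"
        by (simp add: poly_automaton_def)
      then have "?y \<in> {1..d} \<rightarrow>\<^sub>E {0..m - 1}"
        using Cons.prems by (auto simp: PiE_iff)
      then have "state_action ?A y (x # w) ! i = (fps_of_poly G * ?E ?y w) $ (k + d) mod m"
        using Cons.IH[of k ?y] Cons.prems Suc by simp
      also have "(fps_of_poly G * ?E ?y w) $ (k + d) =
          (\<Sum>j=0..k + d. fps_of_poly G $ j * ?E y (x # w) $ (Suc (k + d) - j))"
        unfolding fps_mult_nth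
      proof (rule sum.cong)
        fix j assume "j \<in> {0..k + d}"
        then have "Suc (k + d) - j = Suc (k + d - j)" by auto
        \<comment> \<open>The window slides: the new series is the old one without its constant
          term, moved down by one place.\<close>
        moreover have "?E ?y w $ j = ?E y (x # w) $ Suc j" for j
          unfolding E y' by (auto simp: Suc_diff_le)
        ultimately show "fps_of_poly G $ j * ?E ?y w $ (k + d - j) =
            fps_of_poly G $ j * ?E y (x # w) $ (Suc (k + d) - j)" by simp
      qed simp
      \<comment> \<open>The additional term carries the coefficient of \<open>G\<close> at
        \<open>Suc (k + d)\<close>, which lies beyond its degree.\<close>
      also have "\<dots> = (fps_of_poly G * ?E y (x # w)) $ (Suc (k + d))"
        unfolding fps_mult_nth using degree
        by (simp add: coeff_eq_0 del: fps_add_nth)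
      finally show ?thesis using Suc by simp
    qed
  qed simp
  have len: "length (state_action ?A y w) = length w"
    by (induction w arbitrary: y) auto
  show ?thesis
  proof (rule nth_equalityI)
    fix i assume "i < length (state_action ?A y w)"
    then have i: "i < length w" by (simp add: len)
    \<comment> \<open>The factor \<open>fps_X ^ d\<close> cancels the index shift on the input part,
      while the state part contributes the offset.\<close>
    have "(fps_of_poly G * ?E y w) $ (i + d) =
      (fps_of_poly G * word_fps w + fps_shift d (fps_of_poly (G * digit_poly d y))) $ i"
      by (simp add: distrib_left fps_of_poly_mult fps_X_power_mult_nth
          mult.left_commute[of "fps_of_poly G" "fps_X ^ d"])
    then show "state_action ?A y w ! i = affine_map m (fps_of_poly G)
        (fps_shift d (fps_of_poly (G * digit_poly d y))) w ! i"
      using nth[OF i y w] i by (simp del: fps_add_nth)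
  qed (simp add: len)
qed

text \<open>The inner reductions modulo \<open>m\<close> can be removed from the convolution sums,
  so the inverse of g, read as an integer series, inverts \<open>G\<close> modulo
  \<open>m\<close>.\<close>

lemma power_series_unit_inverse:
  fixes G :: "int poly"
  assumes m: "m > 1" and unit: "g \<in> Units (power_series_monoid (residue_ring m))"
    and coeffs: "\<And>i. Polynomial.coeff G i = g i"
  shows "\<exists>h. fps_cong m (fps_of_poly G * h) 1"
proof -
  interpret residues m "residue_ring m" using m by unfold_locales simp
  obtain h where h: "g \<otimes>\<^bsub>power_series_monoid (residue_ring m)\<^esub> h =
      \<one>\<^bsub>power_series_monoid (residue_ring m)\<^esub>"
    using unit by (auto simp: Units_def)
  have "fps_cong m (fps_of_poly G * Abs_fps h) 1"
    unfolding fps_cong_def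
  proof
    fix k
    have "(\<Sum>i\<le>k. g i * h (k - i)) mod m = (\<Sum>i\<le>k. (g i * h (k - i)) mod m) mod m"
      by (rule mod_sum_eq[symmetric])
    also have "\<dots> = (\<Oplus>\<^bsub>residue_ring m\<^esub>i\<in>{..k}. g i \<otimes>\<^bsub>residue_ring m\<^esub> h (k - i))"
      using m by (subst finsum_eq_sum_mod) (auto simp: residue_ring_def)
    also have "\<dots> = 1 $ k"
      using fun_cong[OF h, of k] by (simp add: power_series_monoid_def residue_ring_def)
    finally have "(\<Sum>i\<le>k. g i * h (k - i)) mod m = 1 $ k mod m"
      using m by simp
    then show "[(fps_of_poly G * Abs_fps h) $ k = 1 $ k] (mod m)"
      by (simp add: cong_def fps_mult_nth coeffs atLeast0AtMost)
  qed
  then show ?thesis ..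
qed

section \<open>Generators of the lamplighter group\<close>

lemma generate_lamplighter_group:
  assumes n: "n > 1"
  shows "generate (lamplighter_group n d)
      ((\<lambda>y. (\<lambda>i. if i = 0 then y else (\<lambda>j\<in>{1..d}. 0), 1)) ` ({1..d} \<rightarrow>\<^sub>E {0..int n - 1})) =
    carrier (lamplighter_group n d)"
    (is "generate ?L ?Z = _")
proof -
  let ?V = "{1..d} \<rightarrow>\<^sub>E {0..int n - 1}"
  define z :: "nat \<Rightarrow> int" where "z = (\<lambda>j\<in>{1..d}. 0)"
  define add where "add x y = (\<lambda>j\<in>{1..d}. (x j + y j) mod int n)" for x y :: "nat \<Rightarrow> int"
  define single where "single i y = (\<lambda>j::int. if j = i then y else z)" for i and y :: "nat \<Rightarrow> int"
  interpret L: group ?L by (rule group_lamplighter_group[OF n])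
  have z_in: "z \<in> ?V" using n by (auto simp: z_def)
  have carrier: "(f, k) \<in> carrier ?L \<longleftrightarrow> (\<forall>i. f i \<in> ?V) \<and> finite {i. f i \<noteq> z}" for f k
    unfolding carrier_lamplighter_group[OF n] z_def by simp
  have mult: "(f, k) \<otimes>\<^bsub>?L\<^esub> (f', k') = (\<lambda>i. add (f i) (f' (i - k)), k + k')" for f f' k k'
    unfolding mult_lamplighter_group add_def translation_def ..
  have one: "\<one>\<^bsub>?L\<^esub> = (\<lambda>i. z, 0)"
    unfolding one_lamplighter_group z_def ..
  have add_z: "add x z = x" "add z x = x" if "x \<in> ?V" for x
    using that n by (auto simp: add_def z_def fun_eq_iff PiE_iff extensional_def)
  have Z: "?Z = (\<lambda>y. (single 0 y, 1)) ` ?V"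
    unfolding single_def z_def ..
  have Z_carrier: "?Z \<subseteq> carrier ?L"
  proof -
    have "finite {i. single 0 y i \<noteq> z}" for y
      by (rule finite_subset[of _ "{0}"]) (auto simp: single_def)
    then show ?thesis unfolding Z using z_in by (auto simp: carrier single_def)
  qed
  interpret H: subgroup "generate ?L ?Z" ?L
    by (rule L.generate_is_subgroup[OF Z_carrier])
  have gen: "(single 0 y, 1) \<in> generate ?L ?Z" if "y \<in> ?V" for y
    using that unfolding Z by (intro generate.incl) auto
  \<comment> \<open>The generator with all-zero lamp is the pure unit shift.\<close>
  have shift1: "(\<lambda>i. z, 1) \<in> generate ?L ?Z"
    using gen[OF z_in] by (simp add: single_def cong: if_cong)
  have carrier_z: "(\<lambda>i. z, k) \<in> carrier ?L" for k
    using z_in by (simp add: carrier)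
  have mult_z: "(\<lambda>i. z, k) \<otimes>\<^bsub>?L\<^esub> (\<lambda>i. z, l) = (\<lambda>i. z, k + l)" for k l
    unfolding mult add_z(1)[OF z_in] ..
  have "(\<lambda>i. z, - 1) = inv\<^bsub>?L\<^esub> (\<lambda>i. z, 1)"
    by (rule L.inv_equality[symmetric]) (simp_all only: mult_z one carrier_z add.left_inverse)
  then have shift_minus1: "(\<lambda>i. z, - 1) \<in> generate ?L ?Z"
    using H.m_inv_closed[OF shift1] by simp
  have shift: "(\<lambda>i. z, k) \<in> generate ?L ?Z" for k
  proof (induction k rule: int_induct[of _ 0])
    case base
    show ?case using H.one_closed by (simp add: one)
  next
    case (step1 k)
    from H.m_closed[OF step1(2) shift1] show ?case by (simp only: mult_z diff_conv_add_uminus)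
  next
    case (step2 k)
    from H.m_closed[OF step2(2) shift_minus1] show ?case by (simp only: mult_z diff_conv_add_uminus)
  qed
  have single: "(single i y, 0) \<in> generate ?L ?Z" if y: "y \<in> ?V" for i y
  proof -
    \<comment> \<open>The left factor moves the lamp from 0 to \<open>i\<close>. The generator adds
      1 to the shift, so \<open>- i - 1\<close> is needed to bring the total back to 0.\<close>
    have "(\<lambda>i. z, i) \<otimes>\<^bsub>?L\<^esub> (single 0 y, 1) \<otimes>\<^bsub>?L\<^esub> (\<lambda>i. z, - i - 1) = (single i y, 0)"
      using y z_in by (auto simp: mult single_def add_z fun_eq_iff)
    then show ?thesis using H.m_closed[OF H.m_closed[OF shift gen[OF y]] shift] by metis
  qed
  have sum: "(f, 0) \<in> generate ?L ?Z" if "finite S" "{i. f i \<noteq> z} \<subseteq> S" "\<And>i. f i \<in> ?V" for f S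
    using that
  proof (induction S arbitrary: f rule: finite_induct)
    case empty
    then have "f = (\<lambda>i. z)" by auto
    then show ?case using shift by simp
  next
    case (insert a S)
    \<comment> \<open>Switching off the lamp at \<open>a\<close> brings the support into
      \<open>S\<close>; a single lamp then restores it.\<close>
    have "(f(a := z), 0) \<in> generate ?L ?Z"
      using insert.prems z_in by (intro insert.IH) auto
    moreover have "(single a (f a), 0) \<otimes>\<^bsub>?L\<^esub> (f(a := z), 0) = (f, 0)"
      using insert.prems by (auto simp: mult single_def add_z fun_eq_iff)
    ultimately show ?case using H.m_closed[OF single[OF insert.prems(2)]] by metis
  qed
  have "(f, k) \<in> generate ?L ?Z" if f: "(f, k) \<in> carrier ?L" for f k
  proof -
    have "(f, 0) \<in> generate ?L ?Z" using sum[of "{i. f i \<noteq> z}" f] f by (simp add: carrier)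
    moreover have "(f, 0) \<otimes>\<^bsub>?L\<^esub> (\<lambda>i. z, k) = (f, k)"
      using f by (simp add: mult carrier add_z)
    ultimately show ?thesis using H.m_closed[OF _ shift] by metis
  qed
  then show ?thesis using H.subset by auto
qed

section \<open>The embedding of the lamplighter group into the tree automorphisms\<close>

context invertible_monic
begin

text \<open>The restriction is there because elements of \<open>BijGroup\<close> are extensional
  functions on the set of words.\<close>

definition word_action :: "(int \<Rightarrow> nat \<Rightarrow> int) \<times> int \<Rightarrow> int list \<Rightarrow> int list" where
  "word_action = (\<lambda>(f, k). restrict (affine_map m (int_pow k) (offset_sum f)) (lists {0..m - 1}))"

text \<open>Composing F -> g^k F + U with F -> g^k' F + U' gives linear part g^(k + k') and offset U
  + g^k U'. Up to congruence this is the offset of the product configuration, and congruent series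
  define equal maps because outputs are reduced.\<close>

lemma word_action_hom:
  assumes n: "m = int n"
  shows "word_action \<in> hom (lamplighter_group n d) (TreeAutoGroup {0..m - 1})"
proof (rule homI)
  have n1: "n > 1" using m n by simp
  let ?X = "lists {0..m - 1}"
  have in_tree: "word_action p \<in> tree_auto {0..m - 1}" for p
    unfolding word_action_def using affine_map_tree_auto[OF _ int_pow_inverse] m
    by (simp add: case_prod_unfold)
  show "word_action p \<in> carrier (TreeAutoGroup {0..m - 1})" for p
    using in_tree by (simp add: TreeAutoGroup_def)
  have in_Bij: "word_action p \<in> Bij ?X" for p
    using in_tree[of p] by (simp add: tree_auto_def)
  fix p q assume "p \<in> carrier (lamplighter_group n d)" "q \<in> carrier (lamplighter_group n d)"
  then obtain f k f' k' where p: "p = (f, k)" and q: "q = (f', k')"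
    and f: "finite {i. f i \<noteq> zero_vec}" and f': "finite {i. f' i \<noteq> zero_vec}"
    unfolding carrier_lamplighter_group[OF n1] zero_vec_def by auto
  have "{i. translation k f' i \<noteq> zero_vec} = (\<lambda>i. i + k) ` {i. f' i \<noteq> zero_vec}"
    unfolding translation_def by (rule Collect_diff_eq_image)
  then have tf': "finite {i. translation k f' i \<noteq> zero_vec}" using f' by simp
  have "fps_cong m (offset_sum (\<lambda>i. \<lambda>j\<in>{1..d}. (f i j + translation k f' i j) mod m))
      (offset_sum f + offset_sum (translation k f'))"
    by (rule offset_sum_add[OF f tf'])
  then have "fps_cong m (offset_sum (\<lambda>i. \<lambda>j\<in>{1..d}. (f i j + translation k f' i j) mod m))
      (offset_sum f + int_pow k * offset_sum f')"
    by (rule fps_cong_trans) (intro fps_cong_add offset_sum_translation[OF f'] fps_cong_refl)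
  then have "affine_map m (int_pow (k + k'))
        (offset_sum (\<lambda>i. \<lambda>j\<in>{1..d}. (f i j + translation k f' i j) mod m)) w =
      affine_map m (int_pow k) (offset_sum f) (affine_map m (int_pow k') (offset_sum f') w)" for w
    unfolding affine_map_compose by (intro affine_map_cong int_pow_add) (simp add: add.commute)
  then have "word_action (p \<otimes>\<^bsub>lamplighter_group n d\<^esub> q) = compose ?X (word_action p) (word_action q)"
    using affine_map_in_lists[of m] m
    unfolding p q mult_lamplighter_group n[symmetric] word_action_def compose_def
    by (intro ext) simp
  then show "word_action (p \<otimes>\<^bsub>lamplighter_group n d\<^esub> q) =
      word_action p \<otimes>\<^bsub>TreeAutoGroup {0..m - 1}\<^esub> word_action q"
    using in_Bij by (simp add: TreeAutoGroup_def BijGroup_def)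
qed

text \<open>An identity map has linear part 1 and offset 0 modulo \<open>m\<close>. No nontrivial
  power of g is 1, which gives k = 0, and uniqueness of expansions switches off all lamps.\<close>

lemma word_action_eq_one:
  assumes n: "m = int n" and p: "p \<in> carrier (lamplighter_group n d)"
    and one: "word_action p = \<one>\<^bsub>TreeAutoGroup {0..m - 1}\<^esub>"
  shows "p = \<one>\<^bsub>lamplighter_group n d\<^esub>"
proof -
  have n1: "n > 1" using m n by simp
  obtain f k where fk: "p = (f, k)" and f: "finite {i. f i \<noteq> zero_vec}" "\<And>i. f i \<in> vectors"
    using p unfolding carrier_lamplighter_group[OF n1] zero_vec_def n by auto
  have "affine_map m (int_pow k) (offset_sum f) w = w" if "w \<in> lists {0..m - 1}" for w
    using fun_cong[OF one, of w] that
    by (simp add: fk word_action_def TreeAutoGroup_def BijGroup_def)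
  from affine_map_eq_id[OF m this]
  have "fps_cong m (int_pow k) 1" "fps_cong m (offset_sum f) 0" by auto
  then have "k = 0" "f = (\<lambda>i. zero_vec)"
    using int_pow_cong_1 offset_sum_cong_0[OF f] by auto
  then show ?thesis by (simp add: fk one_lamplighter_group zero_vec_def)
qed

text \<open>This is the map by which the state \<open>y\<close> acts: only the term at index 0
  contributes to the offset, and the unit shift gives linear part g.\<close>

lemma word_action_generator:
  "word_action (\<lambda>i. if i = 0 then y else (\<lambda>j\<in>{1..d}. 0), 1) =
    restrict (affine_map m (fps_of_poly G) (offset y)) (lists {0..m - 1})"
proof -
  let ?f = "\<lambda>i::int. if i = 0 then y else zero_vec"
  have "offset_sum ?f = (\<Sum>i\<in>{0}. int_pow i * offset (?f i))"
    by (rule offset_sum_eq) auto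
  then have "offset_sum ?f = offset y" by simp
  then show ?thesis unfolding word_action_def zero_vec_def[symmetric] by simp
qed

text \<open>A homomorphism maps a generated subgroup onto the subgroup generated by the images. Here
  the generators give the whole lamplighter group, and the trivial kernel gives injectivity.\<close>

lemma lamplighter_iso_subgroup_generated:
  assumes n: "m = int n"
  shows "lamplighter_group n d \<cong> subgroup_generated (TreeAutoGroup {0..m - 1})
    ((\<lambda>y. restrict (affine_map m (fps_of_poly G) (offset y)) (lists {0..m - 1})) ` vectors)"
proof -
  have n1: "n > 1" using m n by simp
  define L where "L = lamplighter_group n d"
  define T where "T = TreeAutoGroup {0..m - 1}"
  define Z where "Z = (\<lambda>y. (\<lambda>i::int. if i = 0 then y else (\<lambda>j\<in>{1..d}. 0), 1::int)) ` vectors"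
  interpret group_hom L T word_action
    unfolding L_def T_def
    by (intro group_hom.intro group_hom_axioms.intro group_lamplighter_group[OF n1]
        group_TreeAutoGroup word_action_hom[OF n])
  have gen: "generate L Z = carrier L"
    unfolding L_def Z_def n by (rule generate_lamplighter_group[OF n1])
  have Z: "Z \<subseteq> carrier L"
    unfolding gen[symmetric] by (rule subsetI) (rule generate.incl)
  \<comment> \<open>\<open>subgroup_generated\<close> intersects its generators with the carrier, so
    this inclusion keeps all of them.\<close>
  then have "word_action ` Z \<subseteq> carrier T" by auto
  then have carrier: "carrier (subgroup_generated T (word_action ` Z)) = word_action ` carrier L"
    by (simp only: carrier_subgroup_generated Int_absorb1 generate_img[OF Z] gen)
  have mult: "p \<otimes>\<^bsub>subgroup_generated T (word_action ` Z)\<^esub> q = p \<otimes>\<^bsub>T\<^esub> q" for p q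
    by (simp add: subgroup_generated_def)
  have "word_action \<in> iso L (subgroup_generated T (word_action ` Z))"
  proof (rule isoI)
    show "word_action \<in> hom L (subgroup_generated T (word_action ` Z))"
      by (rule homI) (simp_all only: carrier mult hom_mult imageI)
    have "inj_on word_action (carrier L)"
      unfolding inj_on_one_iff unfolding L_def T_def
      by (intro allI impI word_action_eq_one[OF n])
    then show "bij_betw word_action (carrier L) (carrier (subgroup_generated T (word_action ` Z)))"
      by (simp add: bij_betw_def carrier)
  qed
  then have "L \<cong> subgroup_generated T (word_action ` Z)" by (rule is_isoI)
  moreover have "word_action ` Z =
      (\<lambda>y. restrict (affine_map m (fps_of_poly G) (offset y)) (lists {0..m - 1})) ` vectors"
    unfolding Z_def image_image word_action_generator ..
  ultimately show ?thesis unfolding L_def T_def by (simp only:)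
qed

end

theorem proposition2:
  fixes n d :: nat and R :: "int ring" and g :: "nat \<Rightarrow> int"
  defines "R \<equiv> residue_ring (int n)"
  assumes "n \<ge> 2" and "d \<ge> 1"
    and "g \<in> carrier (UP R)" and "deg R g = d" and "coeff (UP R) g d = \<one>\<^bsub>R\<^esub>"
    and "g \<in> Units (power_series_monoid R)"
  shows "automaton_group (poly_automaton R d g) \<cong> lamplighter_group n d"
proof -
  define m where "m = int n"
  have m: "m > 1" using assms(2) by (simp add: m_def)
  have R: "R = residue_ring m" by (simp add: R_def m_def)
  interpret residues m R using m by (rule residues.intro) (simp add: R)
  interpret UP_cring R "UP R" using cring by (simp_all add: UP_cring_def)
  have coeff: "coeff (UP R) g i = g i" for i using assms(4) by (simp add: UP_def)
  have g_d: "g d = 1" using assms(6)[unfolded coeff] by (simp add: R residue_ring_def)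
  have g_above: "g i = 0" if "i > d" for i
    using deg_aboveD[of g i, unfolded coeff] that assms(4,5) by (simp add: R residue_ring_def)
  \<comment> \<open>The integer lift of g has the same coefficients. It is monic of degree
    \<open>d\<close> over the integers because the one and zero of \<open>residue_ring m\<close> are
    the integers 1 and 0.\<close>
  define G where "G = (\<Sum>i\<le>d. Polynomial.monom (g i) i)"
  have coeffs: "Polynomial.coeff G i = g i" for i
    using g_above by (auto simp: G_def coeff_sum)
  have degree: "degree G = d"
    using g_d g_above by (intro antisym degree_le le_degree) (auto simp: coeffs)
  obtain h where "fps_cong m (fps_of_poly G * h) 1"
    using power_series_unit_inverse[OF m assms(7)[unfolded R] coeffs] by blast
  then interpret invertible_monic m d G h
    using m assms(3) degree g_d by unfold_locales (simp_all add: coeffs)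
  have states: "states (poly_automaton R d g) = vectors"
    and alphabet: "alphabet (poly_automaton R d g) = {0..m - 1}"
    by (simp_all add: poly_automaton_def R residue_ring_def)
  have "state_automorphism (poly_automaton R d g) y =
      restrict (affine_map m (fps_of_poly G) (offset y)) (lists {0..m - 1})" if "y \<in> vectors" for y
    unfolding state_automorphism_def offset_def alphabet unfolding R
    by (intro restrict_ext poly_automaton_action[OF m assms(3) assms(4)[unfolded R] coeffs degree that])
  then have "automaton_group (poly_automaton R d g) = subgroup_generated (TreeAutoGroup {0..m - 1})
    ((\<lambda>y. restrict (affine_map m (fps_of_poly G) (offset y)) (lists {0..m - 1})) ` vectors)"
    unfolding automaton_group_def states alphabet by (simp cong: image_cong)
  then show ?thesis
    using group.iso_sym[OF group_lamplighter_group lamplighter_iso_subgroup_generated[OF m_def]] assms(2)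
    by simp
qed

end
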